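(* Let $A\in\mathbb{R}^{n\times n}$ with $A\ge0$, $B\in\mathbb{R}^{n\times m}$, $C\in\mathbb{R}^{p\times n}$, $E\in\mathbb{R}^{n\times q}$ with $E\ge 0$, and $F\in\mathbb{R}^{p\times r}$ (no sign restriction). Consider \[ x(t+1)=Ax(t)+Bu(t)+Ew(t),\qquad y(t)=Cx(t)+Fv(t), \] where $w(t)\in\mathbb{R}^q_+$ and $v(t)\in\mathbb{R}^r_+$ are random vectors with $\mathbb{E}[w(t)]=\mathbf{1}$ and $\mathbb{E}[v(t)]=\mathbf{1}$ for all $t$. Let the upper and lower estimates evolve as \[ \overline{x}(t+1)=(A-\overline{L}C)\overline{x}(t)+\overline{L}y(t)+Bu(t),\qquad \underline{x}(t+1)=(A-\underline{L}C)\underline{x}(t)+\underline{L}y(t)+Bu(t), \] with $\overline{L},\underline{L}\in\mathbb{R}^{n\times p}$, and let $u(t)=\overline{K}\,\overline{x}(t)+\underline{K}\,\underline{x}(t)$ with $\overline{K},\underline{K}\in\mathbb{R}^{m\times n}$. Let $X(t)=\mathbb{E}[(x(t),\overline{x}(t),\underline{x}(t))]\in\mathbb{R}^{3n}$ and $\mathcal{X}=\{(x,\overline{x},\underline{x}) : x,\overline{x},\underline{x}\in\mathbb{R}^n_+,\ \underline{x}\le x\le \overline{x}\}$, and suppose the initialization satisfies $X(0)\in\mathcal{X}$. Then the following are equivalent: (i) The matrices $A+B(\overline{K}+\underline{K})$, $A-\overline{L}C$ and $A-\underline{L}C$ are Schur, and \[ A+B(\overline{K}+\underline{K})\ge 0,\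 A+B\overline{K}\ge0,\ B\overline{K}\ge0,\ A-\overline{L}C\ge0,\ A-\underline{L}C\ge0,\ B\overline{K}+\underline{L}C\ge0, \] \[ \overline{L}F\mathbf{1}-E\mathbf{1}\ge0,\quad E\mathbf{1}-\underline{L}F\mathbf{1}\ge0,\quad \underline{L}F\mathbf{1}\ge 0. \] (ii) For all initial conditions with $x(0)\in\mathbb{R}^n_+$ and $X(0)\in\mathcal{X}$, the expected state satisfies $X(t)\in\mathcal{X}$ for all $t\ge0$ and $X(t)$ converges asymptotically to a single fixed point $X^*\in\mathcal{X}$.
   Context: All inequalities between matrices or vectors are element-wise; $\mathbb{R}^k_+$ is the closed nonnegative orthant and $\mathbf{1}$ denotes a vector of ones of the appropriate dimension. A square matrix is Schur if its spectral radius is less than $1$. *)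

theory Defs
  imports "HOL-Analysis.Analysis" "HOL-Probability.Probability"
begin

text \<open>Complex eigenvalues of a real square matrix, spectral radius, Schur stability.\<close>

definition cmat :: "real^'n^'n \<Rightarrow> complex^'n^'n" where
  "cmat A = (\<chi> i j. complex_of_real (A $ i $ j))"

definition eigenvalues_c :: "real^'n^'n \<Rightarrow> complex set" where
  "eigenvalues_c A = {c. \<exists>v::complex^'n. v \<noteq> 0 \<and> cmat A *v v = c *s v}"

definition spec_rad :: "real^'n^'n \<Rightarrow> real" where
  "spec_rad A = Max (cmod ` eigenvalues_c A)"

definition schur :: "real^'n^'n \<Rightarrow> bool" where
  "schur A \<longleftrightarrow> spec_rad A < 1"

text \<open>Vector of ones.\<close>
abbreviation ones :: "real^'k" where "ones \<equiv> vec 1"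

text \<open>The admissible set \<X> = {(x, xu, xl) : x, xu, xl \<ge> 0, xl \<le> x \<le> xu}.\<close>
definition Xset :: "((real^'n) \<times> (real^'n) \<times> (real^'n)) set" where
  "Xset = {(x, xu, xl). 0 \<le> x \<and> 0 \<le> xu \<and> 0 \<le> xl \<and> xl \<le> x \<and> x \<le> xu}"

text \<open>Closed-loop stochastic trajectory (x(t), upper estimate, lower estimate),
  sample-path-wise, driven by the noise w, v and the initial states.\<close>
fun traj ::
  "real^'n^'n \<Rightarrow> real^'m^'n \<Rightarrow> real^'n^'p \<Rightarrow> real^'q^'n \<Rightarrow> real^'r^'p \<Rightarrow>
   real^'p^'n \<Rightarrow> real^'p^'n \<Rightarrow> real^'n^'m \<Rightarrow> real^'n^'m \<Rightarrow>
   (nat \<Rightarrow> 'a \<Rightarrow> real^'q) \<Rightarrow> (nat \<Rightarrow> 'a \<Rightarrow> real^'r) \<Rightarrow>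
   ('a \<Rightarrow> real^'n) \<Rightarrow> ('a \<Rightarrow> real^'n) \<Rightarrow> ('a \<Rightarrow> real^'n) \<Rightarrow>
   nat \<Rightarrow> 'a \<Rightarrow> (real^'n) \<times> (real^'n) \<times> (real^'n)" where
  "traj A B C E F Lu Ll Ku Kl w v x0 xu0 xl0 0 \<omega> = (x0 \<omega>, xu0 \<omega>, xl0 \<omega>)"
| "traj A B C E F Lu Ll Ku Kl w v x0 xu0 xl0 (Suc t) \<omega> =
    (let (x, xu, xl) = traj A B C E F Lu Ll Ku Kl w v x0 xu0 xl0 t \<omega>;
         u = Ku *v xu + Kl *v xl;
         y = C *v x + F *v v t \<omega>
     in (A *v x + B *v u + E *v w t \<omega>,
         (A - Lu ** C) *v xu + Lu *v y + B *v u,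
         (A - Ll ** C) *v xl + Ll *v y + B *v u))"

end

theory Submission
  imports Defs "Jordan_Normal_Form.Spectral_Radius"
begin

text \<open>
  Taking expectations, the mean \<open>X(t)\<close> of the closed loop follows the deterministic affine
  recursion obtained by replacing the noise by its mean \<open>\<one>\<close>. In the coordinates
  \<open>(xl, x - xl, xu - x)\<close> this recursion is block triangular: the two estimation gaps evolve
  autonomously under \<open>A - Ll C\<close> and \<open>A - Lu C\<close>, and they drive the lower estimate, which
  evolves under \<open>A + B (Ku + Kl)\<close>. The sign conditions are exactly what makes the step map
  send the nonnegative orthant of these coordinates, i.e. \<open>\<X>\<close>, into itself; testing at the
  points \<open>(z, z, 0)\<close>, \<open>(z, z, z)\<close>, \<open>(0, z, 0)\<close> of \<open>\<X>\<close> recovers them. Differences of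
  trajectories evolve under powers of the three diagonal blocks, and a matrix is Schur iff its
  powers send every (equivalently, every nonnegative) vector to \<open>0\<close>; so the Schur conditions are
  exactly what makes all trajectories converge to one common fixed point.
\<close>

\<comment> \<open>The JNF library's infix \<open>$\<close> for vector entries would clash with the Cartesian one.\<close>
no_notation vec_index (infixl \<open>$\<close> 100)

section \<open>Cartesian matrices as JNF matrices\<close>

text \<open>JNF matrices are indexed by \<open>{0..<n}\<close>; an arbitrary enumeration of the finite index type
  transports Cartesian matrices there, so that the Jordan-normal-form bound on matrix powers
  becomes available.\<close>

definition cart_index :: "nat \<Rightarrow> 'n::finite" where
  "cart_index = (SOME f. bij_betw f {0..<CARD('n)} UNIV)"

definition cart_pos :: "'n::finite \<Rightarrow> nat" where
  "cart_pos = the_inv_into {0..<CARD('n)} cart_index"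

lemma bij_betw_cart_index: "bij_betw (cart_index :: nat \<Rightarrow> 'n::finite) {0..<CARD('n)} UNIV"
proof -
  have "\<exists>f. bij_betw f {0..<CARD('n)} (UNIV :: 'n set)"
    by (rule ex_bij_betw_nat_finite) simp
  thus ?thesis unfolding cart_index_def by (rule someI_ex)
qed

lemma cart_index_pos [simp]: "cart_index (cart_pos i) = (i :: 'n::finite)"
  unfolding cart_pos_def by (rule f_the_inv_into_f_bij_betw[OF bij_betw_cart_index]) simp

lemma cart_pos_less [simp]: "cart_pos (i :: 'n::finite) < CARD('n)"
  using bij_betw_apply[OF bij_betw_the_inv_into[OF bij_betw_cart_index]]
  by (simp add: cart_pos_def)

lemma cart_pos_index [simp]: "j < CARD('n) \<Longrightarrow> cart_pos (cart_index j :: 'n::finite) = j"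
  unfolding cart_pos_def
  by (rule the_inv_into_f_f[OF bij_betw_imp_inj_on[OF bij_betw_cart_index]]) simp

lemma sum_cart_index: "(\<Sum>j<CARD('n). f (cart_index j :: 'n::finite)) = (\<Sum>i\<in>UNIV. f i)"
  using sum.reindex_bij_betw[OF bij_betw_cart_index, of f] by (simp add: atLeast0LessThan)

definition jvec_of_cart :: "'a^'n::finite \<Rightarrow> 'a Matrix.vec" where
  "jvec_of_cart v = Matrix.vec CARD('n) (\<lambda>j. v $ cart_index j)"

definition cart_of_jvec :: "'a Matrix.vec \<Rightarrow> 'a^'n::finite" where
  "cart_of_jvec w = (\<chi> i. vec_index w (cart_pos i))"

definition jmat_of_cart :: "'a^'n^'n::finite \<Rightarrow> 'a mat" where
  "jmat_of_cart N = Matrix.mat CARD('n) CARD('n) (\<lambda>(i, j). N $ cart_index i $ cart_index j)"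

lemma jmat_of_cart_carrier [simp]:
  "jmat_of_cart (N :: 'a^'n^'n::finite) \<in> carrier_mat CARD('n) CARD('n)"
  by (simp add: jmat_of_cart_def)

lemma dim_jmat_of_cart [simp]:
  "dim_row (jmat_of_cart (N :: 'a^'n^'n::finite)) = CARD('n)"
  "dim_col (jmat_of_cart (N :: 'a^'n^'n::finite)) = CARD('n)"
  by (simp_all add: jmat_of_cart_def)

lemma dim_vec_jvec_of_cart [simp]: "dim_vec (jvec_of_cart (v :: 'a^'n::finite)) = CARD('n)"
  by (simp add: jvec_of_cart_def)

lemma jvec_of_cart_carrier [simp]: "jvec_of_cart (v :: 'a^'n::finite) \<in> carrier_vec CARD('n)"
  by (simp add: jvec_of_cart_def)

lemma jvec_of_cart_index:
  "i < CARD('n) \<Longrightarrow> vec_index (jvec_of_cart (v :: 'a^'n::finite)) i = v $ cart_index i"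
  by (simp add: jvec_of_cart_def)

lemma jvec_of_cart_mult:
  "jmat_of_cart N *\<^sub>v jvec_of_cart v = jvec_of_cart (N *v (v :: 'a::semiring_1^'n::finite))"
proof (rule eq_vecI)
  fix i assume "i < dim_vec (jvec_of_cart (N *v v))"
  hence i: "i < CARD('n)" by (simp add: jvec_of_cart_def)
  have "vec_index (jmat_of_cart N *\<^sub>v jvec_of_cart v) i
      = (\<Sum>j<CARD('n). N $ cart_index i $ cart_index j * v $ cart_index j)"
    using i by (simp add: jmat_of_cart_def jvec_of_cart_def scalar_prod_def atLeast0LessThan)
  also have "\<dots> = vec_index (jvec_of_cart (N *v v)) i"
    using i sum_cart_index[of "\<lambda>j. N $ cart_index i $ j * v $ j"]
    by (simp add: jvec_of_cart_def matrix_vector_mult_def)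
  finally show "vec_index (jmat_of_cart N *\<^sub>v jvec_of_cart v) i
      = vec_index (jvec_of_cart (N *v v)) i" .
qed (simp add: jmat_of_cart_def jvec_of_cart_def)

lemma jvec_of_cart_of_jvec:
  "w \<in> carrier_vec CARD('n) \<Longrightarrow> jvec_of_cart (cart_of_jvec w :: 'a^'n::finite) = w"
  by (intro eq_vecI) (simp_all add: jvec_of_cart_def cart_of_jvec_def)

lemma jvec_of_cart_inject: "jvec_of_cart v = jvec_of_cart w \<longleftrightarrow> v = (w :: 'a^'n::finite)"
proof
  assume "jvec_of_cart v = jvec_of_cart w"
  hence "vec_index (jvec_of_cart v) (cart_pos i) = vec_index (jvec_of_cart w) (cart_pos i)"
    for i :: 'n
    by simp
  thus "v = w" by (simp add: jvec_of_cart_index Finite_Cartesian_Product.vec_eq_iff)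
qed simp

lemma jvec_of_cart_zero [simp]: "jvec_of_cart (0 :: 'a::zero^'n::finite) = 0\<^sub>v CARD('n)"
  by (intro eq_vecI) (simp_all add: jvec_of_cart_def)

lemma jvec_of_cart_smult: "jvec_of_cart (c *s (v :: 'a::times^'n::finite)) = c \<cdot>\<^sub>v jvec_of_cart v"
  by (intro eq_vecI) (simp_all add: jvec_of_cart_def)

lemma eigenvalues_c_eq_spectrum:
  "eigenvalues_c (N :: real^'n^'n::finite) = spectrum (jmat_of_cart (cmat N))"
proof -
  have "c \<in> eigenvalues_c N \<longleftrightarrow> eigenvalue (jmat_of_cart (cmat N)) c" for c
  proof
    assume "c \<in> eigenvalues_c N"
    then obtain v where "v \<noteq> 0" "cmat N *v v = c *s v" by (auto simp: eigenvalues_c_def)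
    thus "eigenvalue (jmat_of_cart (cmat N)) c"
      unfolding eigenvalue_def eigenvector_def
      by (intro exI[of _ "jvec_of_cart v"])
         (simp add: jvec_of_cart_mult jvec_of_cart_smult
           flip: jvec_of_cart_zero jvec_of_cart_inject)
  next
    assume "eigenvalue (jmat_of_cart (cmat N)) c"
    then obtain w where w: "w \<in> carrier_vec CARD('n)" "w \<noteq> 0\<^sub>v CARD('n)"
      "jmat_of_cart (cmat N) *\<^sub>v w = c \<cdot>\<^sub>v w"
      unfolding eigenvalue_def eigenvector_def by auto
    define v :: "complex^'n" where "v = cart_of_jvec w"
    have w_eq: "jvec_of_cart v = w" using w(1) by (simp add: v_def jvec_of_cart_of_jvec)
    have "v \<noteq> 0" using w(2) w_eq by auto
    moreover have "cmat N *v v = c *s v"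
      using w(3) by (simp flip: jvec_of_cart_inject jvec_of_cart_mult add: jvec_of_cart_smult w_eq)
    ultimately show "c \<in> eigenvalues_c N" by (auto simp: eigenvalues_c_def)
  qed
  thus ?thesis by (auto simp: spectrum_def)
qed

lemma finite_eigenvalues_c: "finite (eigenvalues_c (N :: real^'n^'n::finite))"
  unfolding eigenvalues_c_eq_spectrum by (rule card_finite_spectrum(1)[OF jmat_of_cart_carrier])

lemma eigenvalues_c_nonempty: "eigenvalues_c (N :: real^'n^'n::finite) \<noteq> {}"
  unfolding eigenvalues_c_eq_spectrum by (rule spectrum_non_empty[OF jmat_of_cart_carrier]) simp

lemma spec_rad_eigenvalue: "\<exists>l \<in> eigenvalues_c N. spec_rad N = cmod l"
proof -
  have "spec_rad N \<in> cmod ` eigenvalues_c N"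
    unfolding spec_rad_def using finite_eigenvalues_c[of N] eigenvalues_c_nonempty[of N] by simp
  thus ?thesis by auto
qed

lemma eigenvalue_le_spec_rad: "l \<in> eigenvalues_c N \<Longrightarrow> cmod l \<le> spec_rad N"
  unfolding spec_rad_def using finite_eigenvalues_c[of N] by simp

section \<open>Schur matrices\<close>

lemma funpow_mult_vec_diff:
  "((*v) (N :: 'a::ring_1^'n^'n) ^^ k) (a - b) = ((*v) N ^^ k) a - ((*v) N ^^ k) b"
  by (induction k) (simp_all add: matrix_vector_mult_diff_distrib)

lemma funpow_mult_vec_add:
  "((*v) (N :: 'a::semiring_1^'n^'n) ^^ k) (a + b) = ((*v) N ^^ k) a + ((*v) N ^^ k) b"
  by (induction k) (simp_all add: matrix_vector_right_distrib)

lemma funpow_mult_vec_scaleR: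
  "((*v) (s *\<^sub>R (N :: real^'n^'n)) ^^ k) z = s ^ k *\<^sub>R ((*v) N ^^ k) z"
  by (induction k)
     (simp_all add: scaleR_matrix_vector_assoc matrix_vector_mult_scaleR mult_ac)

lemma funpow_mult_vec_fixpoint: "(N :: 'a::semiring_1^'n^'n) *v d = d \<Longrightarrow> ((*v) N ^^ k) d = d"
  by (induction k) simp_all

lemma funpow_mult_vec_zero [simp]: "((*v) (N :: 'a::semiring_1^'n^'n) ^^ k) 0 = 0"
  by (induction k) simp_all

definition cvec :: "real^'n \<Rightarrow> complex^'n" where
  "cvec z = (\<chi> i. complex_of_real (z $ i))"

lemma cmat_mult_cvec: "cmat N *v cvec z = cvec (N *v z)"
  by (simp add: cmat_def cvec_def matrix_vector_mult_def Finite_Cartesian_Product.vec_eq_iff)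

lemma jmat_power_mult_jvec:
  "jmat_of_cart (cmat N) ^\<^sub>m k *\<^sub>v jvec_of_cart (cvec z)
     = jvec_of_cart (cvec (((*v) N ^^ k) (z :: real^'n::finite)))"
proof (induction k arbitrary: z)
  case 0
  show ?case by simp
next
  case (Suc k)
  have "jmat_of_cart (cmat N) ^\<^sub>m Suc k *\<^sub>v jvec_of_cart (cvec z)
      = jmat_of_cart (cmat N) ^\<^sub>m k *\<^sub>v (jmat_of_cart (cmat N) *\<^sub>v jvec_of_cart (cvec z))"
    by (simp add: assoc_mult_mat_vec[OF pow_carrier_mat[OF jmat_of_cart_carrier]
          jmat_of_cart_carrier jvec_of_cart_carrier])
  also have "\<dots> = jvec_of_cart (cvec (((*v) N ^^ Suc k) z))"
    by (simp add: jvec_of_cart_mult cmat_mult_cvec Suc funpow_Suc_right del: funpow.simps)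
  finally show ?case .
qed

lemma cmat_scaleR_mult: "cmat (s *\<^sub>R N) *v v = complex_of_real s *s (cmat N *v v)"
  by (simp add: cmat_def matrix_vector_mult_def Finite_Cartesian_Product.vec_eq_iff
      sum_distrib_left algebra_simps)

lemma eigenvalue_scaleR:
  "l \<in> eigenvalues_c N \<Longrightarrow> complex_of_real s * l \<in> eigenvalues_c (s *\<^sub>R N)"
  by (auto simp: eigenvalues_c_def cmat_scaleR_mult)

lemma spec_rad_nonneg: "0 \<le> spec_rad N"
  using spec_rad_eigenvalue[of N] by auto

lemma bounded_powers_if_spec_rad_less_1:
  assumes "spec_rad N < 1"
  shows "\<exists>c. \<forall>k z. norm (((*v) N ^^ k) z) \<le> c * norm (z :: real^'n)"
proof -
  let ?J = "jmat_of_cart (cmat N)"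
  have "spectral_radius ?J = spec_rad N"
    by (simp add: spectral_radius_def spec_rad_def eigenvalues_c_eq_spectrum)
  then obtain c where "\<And>k. norm_bound (?J ^\<^sub>m k) c"
    using assms spectral_radius_jnf_norm_bound_less_1_upper_triangular[OF jmat_of_cart_carrier,
        of "cmat N"] by auto
  hence entry: "cmod ((?J ^\<^sub>m k) $$ (i, j)) \<le> c" if "i < CARD('n)" "j < CARD('n)" for i j k
    using that by (simp add: norm_bound_def)
  have component: "\<bar>((*v) N ^^ k) z $ i\<bar> \<le> CARD('n) * c * norm z" for k z i
  proof -
    have "complex_of_real (((*v) N ^^ k) z $ i)
        = vec_index (jvec_of_cart (cvec (((*v) N ^^ k) z))) (cart_pos i)"
      by (simp add: jvec_of_cart_index cvec_def)
    also have "\<dots> = vec_index (?J ^\<^sub>m k *\<^sub>v jvec_of_cart (cvec z)) (cart_pos i)"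
      by (simp only: jmat_power_mult_jvec)
    also have "\<dots> = (\<Sum>j<CARD('n).
        (?J ^\<^sub>m k) $$ (cart_pos i, j) * complex_of_real (z $ cart_index j))"
      using pow_carrier_mat[OF jmat_of_cart_carrier]
      by (simp add: scalar_prod_def jvec_of_cart_index cvec_def atLeast0LessThan)
    finally have expansion: "complex_of_real (((*v) N ^^ k) z $ i) = (\<Sum>j<CARD('n).
        (?J ^\<^sub>m k) $$ (cart_pos i, j) * complex_of_real (z $ cart_index j))" .
    have "\<bar>((*v) N ^^ k) z $ i\<bar> = cmod (complex_of_real (((*v) N ^^ k) z $ i))"
      by simp
    also have "\<dots> \<le> (\<Sum>j<CARD('n).
        cmod ((?J ^\<^sub>m k) $$ (cart_pos i, j) * complex_of_real (z $ cart_index j)))"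
      unfolding expansion by (rule norm_sum)
    also have "\<dots> \<le> (\<Sum>j<CARD('n). c * norm z)"
      by (intro sum_mono)
         (simp add: norm_mult entry mult_mono' component_le_norm_cart)
    finally show ?thesis by simp
  qed
  have "norm (((*v) N ^^ k) z) \<le> (CARD('n) * CARD('n) * c) * norm z" for k z
  proof -
    have "norm (((*v) N ^^ k) z) \<le> (\<Sum>i\<in>UNIV. \<bar>((*v) N ^^ k) z $ i\<bar>)"
      by (rule norm_le_l1_cart)
    also have "\<dots> \<le> (\<Sum>i\<in>(UNIV :: 'n set). CARD('n) * c * norm z)"
      by (intro sum_mono component)
    finally show ?thesis by simp
  qed
  thus ?thesis by blast
qed

lemma schur_exponential_bound:
  assumes "schur N"
  shows "\<exists>c r. 0 < r \<and> r < 1 \<and> (\<forall>k z. norm (((*v) N ^^ k) z) \<le> c * r ^ k * norm (z :: real^'n))"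
proof -
  \<comment> \<open>For \<open>spec_rad N < r < 1\<close>, the matrix \<open>N / r\<close> has bounded powers.\<close>
  define r where "r = (1 + spec_rad N) / 2"
  have r: "spec_rad N < r" "0 < r" "r < 1"
    using assms spec_rad_nonneg[of N] by (auto simp: schur_def r_def)
  define N' where "N' = inverse r *\<^sub>R N"
  have "spec_rad N' < 1"
  proof -
    obtain l where l: "l \<in> eigenvalues_c N'" "spec_rad N' = cmod l"
      using spec_rad_eigenvalue by blast
    have "N = r *\<^sub>R N'" using r by (simp add: N'_def)
    hence "complex_of_real r * l \<in> eigenvalues_c N"
      using eigenvalue_scaleR[OF l(1)] by simp
    hence "r * cmod l \<le> spec_rad N"
      using eigenvalue_le_spec_rad r(2) by (fastforce simp: norm_mult)
    hence "r * cmod l < r * 1" using r(1) by simp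
    thus ?thesis using l(2) r(2) by simp
  qed
  then obtain c where c: "\<And>k z. norm (((*v) N' ^^ k) z) \<le> c * norm (z :: real^'n)"
    using bounded_powers_if_spec_rad_less_1 by blast
  have "norm (((*v) N ^^ k) z) \<le> c * r ^ k * norm z" for k z
  proof -
    have "((*v) N ^^ k) z = r ^ k *\<^sub>R ((*v) N' ^^ k) z"
      using r by (simp add: N'_def funpow_mult_vec_scaleR flip: power_mult_distrib)
    thus ?thesis
      using mult_left_mono[OF c[of k z], of "r ^ k"] r by (simp add: mult_ac)
  qed
  thus ?thesis using r by blast
qed

lemma powers_tendsto_zero_if_schur:
  assumes "schur N"
  shows "(\<lambda>k. ((*v) N ^^ k) z) \<longlonglongrightarrow> (0 :: real^'n)"
proof -
  obtain c r where r: "0 < r" "r < 1"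
    and bound: "\<And>k. norm (((*v) N ^^ k) z) \<le> c * r ^ k * norm z"
    using schur_exponential_bound[OF assms] by blast
  have "(\<lambda>k. c * r ^ k * norm z) \<longlonglongrightarrow> 0"
    using r by (intro tendsto_mult_left_zero tendsto_mult_right_zero LIMSEQ_power_zero) simp
  thus ?thesis
    by (rule Lim_null_comparison[rotated]) (simp add: bound)
qed

lemma cmat_mult_complexify:
  "cmat N *v (cvec a + \<i> *s cvec b) = cvec (N *v a) + \<i> *s cvec (N *v b)"
  by (simp add: matrix_vector_right_distrib vector_scalar_commute cmat_mult_cvec)

lemma schur_if_powers_tendsto_zero:
  assumes "\<And>z. (\<lambda>k. ((*v) N ^^ k) z) \<longlonglongrightarrow> (0 :: real^'n)"
  shows "schur N"
proof -
  obtain l where l: "l \<in> eigenvalues_c N" "spec_rad N = cmod l"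
    using spec_rad_eigenvalue by blast
  then obtain v where v: "v \<noteq> 0" "cmat N *v v = l *s v"
    by (auto simp: eigenvalues_c_def)
  then obtain i where vi: "v $ i \<noteq> 0"
    by (auto simp: Finite_Cartesian_Product.vec_eq_iff)
  define a b where "a = (\<chi> j. Re (v $ j))" and "b = (\<chi> j. Im (v $ j))"
  have v_eq: "v = cvec a + \<i> *s cvec b"
    by (simp add: a_def b_def cvec_def Finite_Cartesian_Product.vec_eq_iff complex_eq_iff)
  have "(((*v) (cmat N)) ^^ k) v = l ^ k *s v" for k
    by (induction k) (simp_all add: vector_scalar_commute v(2) mult.commute)
  moreover have "(((*v) (cmat N)) ^^ k) v
      = cvec (((*v) N ^^ k) a) + \<i> *s cvec (((*v) N ^^ k) b)" for k
    by (induction k) (simp_all add: v_eq cmat_mult_complexify)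
  ultimately have component: "l ^ k * v $ i
      = complex_of_real (((*v) N ^^ k) a $ i) + \<i> * complex_of_real (((*v) N ^^ k) b $ i)" for k
    by (metis (no_types) cvec_def vector_add_component vector_smult_component vec_lambda_beta)
  have "(\<lambda>k. complex_of_real (((*v) N ^^ k) a $ i) + \<i> * complex_of_real (((*v) N ^^ k) b $ i))
      \<longlonglongrightarrow> 0"
    using tendsto_vec_nth[OF assms[of a], of i] tendsto_vec_nth[OF assms[of b], of i]
    by (auto intro!: tendsto_add_zero tendsto_mult_right_zero
        tendsto_of_real[where 'a=complex, of _ 0, simplified])
  hence lim: "(\<lambda>k. cmod l ^ k * cmod (v $ i)) \<longlonglongrightarrow> 0"
    unfolding component[symmetric] using tendsto_norm_zero by (force simp: norm_mult norm_power)
  have "cmod l < 1"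
  proof (rule ccontr)
    assume "\<not> cmod l < 1"
    hence "cmod (v $ i) \<le> cmod l ^ k * cmod (v $ i)" for k
      using mult_right_mono[OF one_le_power[of "cmod l" k], of "cmod (v $ i)"] by simp
    hence "cmod (v $ i) \<le> 0" by (intro LIMSEQ_le_const[OF lim]) simp
    thus False using vi by simp
  qed
  thus ?thesis using l(2) by (simp add: schur_def)
qed

section \<open>Affine recursions driven by a Schur matrix\<close>

lemma LIMSEQ_zero_if_perturbed_contraction:
  fixes a b :: "nat \<Rightarrow> real"
  assumes a_nonneg: "\<And>t. 0 \<le> a t" and step: "\<And>t. a (Suc t) \<le> \<rho> * a t + b t"
    and \<rho>: "0 \<le> \<rho>" "\<rho> < 1" and b: "b \<longlonglongrightarrow> 0"
  shows "a \<longlonglongrightarrow> 0"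
proof (rule LIMSEQ_I)
  fix \<epsilon> :: real assume \<epsilon>: "0 < \<epsilon>"
  obtain T where T: "\<And>t. t \<ge> T \<Longrightarrow> b t < (1 - \<rho>) * \<epsilon> / 2"
    using order_tendstoD(2)[OF b, of "(1 - \<rho>) * \<epsilon> / 2"] \<epsilon> \<rho>
    by (auto simp: eventually_sequentially)
  \<comment> \<open>Beyond \<open>T\<close>, the excess of \<open>a\<close> over \<open>\<epsilon> / 2\<close> contracts by the factor \<open>\<rho>\<close>.\<close>
  define f where "f m = a (T + m) - \<epsilon> / 2" for m
  have f_bound: "f m \<le> \<rho> ^ m * \<bar>f 0\<bar>" for m
  proof (induction m)
    case (Suc m)
    have "f (Suc m) \<le> \<rho> * a (T + m) + (1 - \<rho>) * \<epsilon> / 2 - \<epsilon> / 2"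
      using step[of "T + m"] T[of "T + m"] by (simp add: f_def)
    also have "\<dots> = \<rho> * f m" by (simp add: f_def field_simps)
    also have "\<dots> \<le> \<rho> * (\<rho> ^ m * \<bar>f 0\<bar>)" using Suc \<rho>(1) by (rule mult_left_mono)
    finally show ?case by simp
  qed simp
  have "(\<lambda>m. \<rho> ^ m * \<bar>f 0\<bar>) \<longlonglongrightarrow> 0"
    using \<rho> by (intro tendsto_mult_left_zero LIMSEQ_power_zero) simp
  from order_tendstoD(2)[OF this, of "\<epsilon> / 2"] \<epsilon>
  obtain m0 where m0: "\<And>m. m \<ge> m0 \<Longrightarrow> \<rho> ^ m * \<bar>f 0\<bar> < \<epsilon> / 2"
    by (auto simp: eventually_sequentially)
  have small: "norm (a (T + m) - 0) < \<epsilon>" if "m \<ge> m0" for m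
    using f_bound[of m] m0[OF that] a_nonneg[of "T + m"] by (simp add: f_def)
  have "norm (a t - 0) < \<epsilon>" if "t \<ge> T + m0" for t
    using small[of "t - T"] that by simp
  thus "\<exists>t0. \<forall>t\<ge>t0. norm (a t - 0) < \<epsilon>" by blast
qed

lemma schur_lyapunov_function:
  assumes "schur N"
  obtains \<rho> and V :: "real^'n \<Rightarrow> real" and M
  where "0 \<le> \<rho>" "\<rho> < 1" "\<And>x. norm x \<le> V x" "\<And>x. V x \<le> M * norm x"
    "\<And>x y. V (x + y) \<le> V x + V y" "\<And>x. V (N *v x) \<le> \<rho> * V x"
proof -
  obtain c r where r: "0 < r" "r < 1"
    and bound: "\<And>k z. norm (((*v) N ^^ k) z) \<le> c * r ^ k * norm (z :: real^'n)"
    using schur_exponential_bound[OF assms] by blast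
  have "(\<lambda>k. c * r ^ k) \<longlonglongrightarrow> 0"
    using r by (intro tendsto_mult_right_zero LIMSEQ_power_zero) simp
  from order_tendstoD(2)[OF this, of "1 / 2"]
  obtain K0 where K0: "\<And>k. k \<ge> K0 \<Longrightarrow> c * r ^ k < 1 / 2"
    by (auto simp: eventually_sequentially)
  \<comment> \<open>Summing the first \<open>K\<close> orbit norms, with \<open>N\<^sup>K\<close> contracting by \<open>1/2\<close>, gives a norm
    that \<open>N\<close> decreases by a fixed factor.\<close>
  define K where "K = Suc K0"
  define V where "V x = (\<Sum>k<K. norm (((*v) N ^^ k) x))" for x
  define M where "M = real K * \<bar>c\<bar> + 1"
  define \<rho> where "\<rho> = 1 - 1 / (2 * M)"
  have M: "1 \<le> M" by (simp add: M_def)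
  have norm_le_V: "norm x \<le> V x" for x
    unfolding V_def K_def sum.lessThan_Suc_shift by (simp add: sum_nonneg)
  have V_le: "V x \<le> M * norm x" for x
  proof -
    have "V x \<le> (\<Sum>k<K. \<bar>c\<bar> * norm x)"
      unfolding V_def
    proof (rule sum_mono)
      fix k
      have "c * r ^ k * norm x \<le> \<bar>c\<bar> * 1 * norm x"
        using r by (intro mult_right_mono mult_mono) (simp_all add: power_le_one)
      thus "norm (((*v) N ^^ k) x) \<le> \<bar>c\<bar> * norm x" using bound[of k x] by simp
    qed
    also have "\<dots> \<le> M * norm x" by (simp add: M_def distrib_right)
    finally show ?thesis .
  qed
  have V_triangle: "V (x + y) \<le> V x + V y" for x y
    unfolding V_def sum.distrib[symmetric]
    by (intro sum_mono) (simp add: funpow_mult_vec_add norm_triangle_ineq)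
  have V_step: "V (N *v x) \<le> \<rho> * V x" for x
  proof -
    have "((*v) N ^^ k) (N *v x) = ((*v) N ^^ Suc k) x" for k
      by (simp only: funpow_Suc_right o_apply)
    hence "V (N *v x) = (\<Sum>k<K. norm (((*v) N ^^ Suc k) x))"
      by (simp add: V_def)
    also have "\<dots> = V x + norm (((*v) N ^^ K) x) - norm x"
      using sum.lessThan_Suc_shift[of "\<lambda>k. norm (((*v) N ^^ k) x)" K]
      by (simp add: V_def)
    also have "norm (((*v) N ^^ K) x) \<le> norm x / 2"
      using bound[of K x] mult_right_mono[OF less_imp_le[OF K0[of K]] norm_ge_zero[of x]]
      by (simp add: K_def)
    finally have "V (N *v x) \<le> V x - norm x / 2" by simp
    moreover have "V x / (2 * M) \<le> norm x / 2" using V_le[of x] M by (simp add: field_simps)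
    moreover have "\<rho> * V x = V x - V x / (2 * M)" by (simp add: \<rho>_def algebra_simps)
    ultimately show ?thesis by linarith
  qed
  show ?thesis
    using M by (intro that[of \<rho> V M] norm_le_V V_le V_triangle V_step) (auto simp: \<rho>_def)
qed

lemma schur_perturbed_tendsto_zero:
  assumes "schur N" and step: "\<And>t. d (Suc t) = N *v d t + h t" and "h \<longlonglongrightarrow> 0"
  shows "d \<longlonglongrightarrow> (0 :: real^'n)"
proof -
  obtain \<rho> and V :: "real^'n \<Rightarrow> real" and M where \<rho>: "0 \<le> \<rho>" "\<rho> < 1"
    and norm_le_V: "\<And>x. norm x \<le> V x" and V_le: "\<And>x. V x \<le> M * norm x"
    and V_triangle: "\<And>x y. V (x + y) \<le> V x + V y" and V_step: "\<And>x. V (N *v x) \<le> \<rho> * V x"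
    using schur_lyapunov_function[OF assms(1)] by metis
  have contraction: "V (d (Suc t)) \<le> \<rho> * V (d t) + M * norm (h t)" for t
  proof -
    have "V (d (Suc t)) \<le> V (N *v d t) + V (h t)" unfolding step by (rule V_triangle)
    also have "\<dots> \<le> \<rho> * V (d t) + M * norm (h t)" by (intro add_mono V_step V_le)
    finally show ?thesis .
  qed
  have forcing: "(\<lambda>t. M * norm (h t)) \<longlonglongrightarrow> 0"
    using assms(3) by (intro tendsto_mult_right_zero tendsto_norm_zero)
  have "(\<lambda>t. V (d t)) \<longlonglongrightarrow> 0"
    using order_trans[OF norm_ge_zero norm_le_V] contraction \<rho> forcing
    by (rule LIMSEQ_zero_if_perturbed_contraction)
  thus ?thesis
    by (rule Lim_null_comparison[OF always_eventually, rotated]) (simp add: norm_le_V)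
qed

lemma schur_fixpoint_exists:
  assumes "schur N"
  shows "\<exists>z. z = N *v z + (g :: real^'n)"
proof -
  have lin: "linear (\<lambda>z. z - N *v z)"
    by (intro linear_compose_sub linear_ident matrix_vector_mul_linear)
  have "inj (\<lambda>z. z - N *v z)"
    unfolding linear_injective_0[OF lin]
  proof (intro allI impI)
    fix d assume "d - N *v d = 0"
    hence "N *v d = d" by simp
    hence "(\<lambda>k. d) \<longlonglongrightarrow> 0"
      using powers_tendsto_zero_if_schur[OF assms, of d] by (simp add: funpow_mult_vec_fixpoint)
    thus "d = 0" by (simp add: LIMSEQ_const_iff)
  qed
  with lin have "surj (\<lambda>z. z - N *v z)" by (rule linear_inj_imp_surj)
  then obtain z where "z - N *v z = g" by (metis surjD)
  hence "z = N *v z + g" by (simp add: algebra_simps)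
  thus ?thesis ..
qed

lemma schur_affine_recursion_tendsto:
  assumes "schur N" and fixpoint: "zs = N *v zs + gs"
    and step: "\<And>t. z (Suc t) = N *v z t + g t" and "g \<longlonglongrightarrow> gs"
  shows "z \<longlonglongrightarrow> (zs :: real^'n)"
proof -
  have "(\<lambda>t. z t - zs) \<longlonglongrightarrow> 0"
  proof (rule schur_perturbed_tendsto_zero[OF assms(1)])
    show "z (Suc t) - zs = N *v (z t - zs) + (g t - gs)" for t
    proof -
      have "z (Suc t) - zs = (N *v z t + g t) - (N *v zs + gs)"
        by (simp add: step flip: fixpoint)
      thus ?thesis by (simp add: algebra_simps)
    qed
    show "(\<lambda>t. g t - gs) \<longlonglongrightarrow> 0" using assms(4) by (rule LIM_zero)
  qed
  thus ?thesis by (rule LIM_zero_cancel)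
qed

lemma affine_recursion_diff:
  fixes N :: "'a::ring_1^'n^'n"
  assumes "\<And>t. a (Suc t) = N *v a t + g t" "\<And>t. b (Suc t) = N *v b t + g t"
  shows "b t - a t = ((*v) N ^^ t) (b 0 - a 0)"
proof (induction t)
  case (Suc t)
  have "b (Suc t) - a (Suc t) = N *v (b t - a t)"
    by (simp add: assms matrix_vector_mult_diff_distrib)
  thus ?case by (simp add: Suc)
qed simp

lemma powers_tendsto_zero_if_nonneg:
  fixes N :: "real^'n^'n"
  assumes "\<And>z. 0 \<le> z \<Longrightarrow> (\<lambda>k. ((*v) N ^^ k) z) \<longlonglongrightarrow> 0"
  shows "(\<lambda>k. ((*v) N ^^ k) (z :: real^'n)) \<longlonglongrightarrow> 0"
proof -
  define zp zn :: "real^'n" where "zp = (\<chi> i. max (z $ i) 0)" and "zn = (\<chi> i. max (- (z $ i)) 0)"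
  have "z = zp - zn" by (auto simp: zp_def zn_def Finite_Cartesian_Product.vec_eq_iff max_def)
  hence "((*v) N ^^ k) z = ((*v) N ^^ k) zp - ((*v) N ^^ k) zn" for k
    by (simp only: funpow_mult_vec_diff)
  moreover have "0 \<le> zp" "0 \<le> zn"
    by (simp_all add: zp_def zn_def Finite_Cartesian_Product.less_eq_vec_def)
  hence "(\<lambda>k. ((*v) N ^^ k) zp - ((*v) N ^^ k) zn) \<longlonglongrightarrow> 0 - 0"
    by (intro tendsto_diff assms)
  ultimately show ?thesis by simp
qed

section \<open>Expectation of the closed loop\<close>

lemma integrable_Pair:
  assumes f: "integrable M f" and g: "integrable M g"
  shows "integrable M (\<lambda>x. (f x, g x))"
proof -
  note left = bounded_linear_Pair[OF bounded_linear_ident bounded_linear_zero]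
    and right = bounded_linear_Pair[OF bounded_linear_zero bounded_linear_ident]
  have "integrable M (\<lambda>x. (f x, 0) + (0, g x))"
    by (intro Bochner_Integration.integrable_add integrable_bounded_linear[OF left f]
        integrable_bounded_linear[OF right g])
  thus ?thesis by simp
qed

lemma integral_Pair:
  "integrable M f \<Longrightarrow> integrable M g \<Longrightarrow>
    integral\<^sup>L M (\<lambda>x. (f x, g x)) = (integral\<^sup>L M f, integral\<^sup>L M g)"
  using integral_fst[OF integrable_Pair, of M f g] integral_snd[OF integrable_Pair, of M f g]
  by (simp add: prod_eq_iff)

definition closed_loop_step ::
  "real^'n^'n \<Rightarrow> real^'m^'n \<Rightarrow> real^'n^'p \<Rightarrow> real^'q^'n \<Rightarrow> real^'r^'p \<Rightarrow>
   real^'p^'n \<Rightarrow> real^'p^'n \<Rightarrow> real^'n^'m \<Rightarrow> real^'n^'m \<Rightarrow> real^'q \<Rightarrow> real^'r \<Rightarrow>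
   (real^'n) \<times> (real^'n) \<times> (real^'n) \<Rightarrow> (real^'n) \<times> (real^'n) \<times> (real^'n)" where
  "closed_loop_step A B C E F Lu Ll Ku Kl w v X = (case X of (x, xu, xl) \<Rightarrow>
     let u = Ku *v xu + Kl *v xl; y = C *v x + F *v v
     in (A *v x + B *v u + E *v w,
         (A - Lu ** C) *v xu + Lu *v y + B *v u,
         (A - Ll ** C) *v xl + Ll *v y + B *v u))"

lemma traj_Suc_closed_loop_step:
  "traj A B C E F Lu Ll Ku Kl w v x0 xu0 xl0 (Suc t) \<omega>
     = closed_loop_step A B C E F Lu Ll Ku Kl (w t \<omega>) (v t \<omega>)
         (traj A B C E F Lu Ll Ku Kl w v x0 xu0 xl0 t \<omega>)"
  by (simp add: closed_loop_step_def split: prod.split)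

lemma bounded_linear_closed_loop_step:
  "bounded_linear (\<lambda>(X, w, v). closed_loop_step A B C E F Lu Ll Ku Kl w v X)"
  unfolding linear_conv_bounded_linear[symmetric]
  by (rule linearI) (auto simp: closed_loop_step_def Let_def algebra_simps split: prod.splits)

context
  fixes M :: "'a measure" and w :: "nat \<Rightarrow> 'a \<Rightarrow> real^'q" and v :: "nat \<Rightarrow> 'a \<Rightarrow> real^'r"
    and x0 xu0 xl0 :: "'a \<Rightarrow> real^'n"
  assumes w_int: "\<And>t. integrable M (w t)" and v_int: "\<And>t. integrable M (v t)"
    and init_int: "integrable M x0" "integrable M xu0" "integrable M xl0"
begin

lemma integrable_traj: "integrable M (traj A B C E F Lu Ll Ku Kl w v x0 xu0 xl0 t)"
proof (induction t)
  case 0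
  show ?case using init_int by (simp add: integrable_Pair)
next
  case (Suc t)
  show ?case
    unfolding traj_Suc_closed_loop_step
    using integrable_bounded_linear[OF bounded_linear_closed_loop_step
        integrable_Pair[OF Suc integrable_Pair[OF w_int v_int]]]
    by simp
qed

lemma integral_traj:
  assumes "\<And>t. integral\<^sup>L M (w t) = w_mean" and "\<And>t. integral\<^sup>L M (v t) = v_mean"
  shows "integral\<^sup>L M (traj A B C E F Lu Ll Ku Kl w v x0 xu0 xl0 t)
    = (closed_loop_step A B C E F Lu Ll Ku Kl w_mean v_mean ^^ t)
        (integral\<^sup>L M (\<lambda>\<omega>. (x0 \<omega>, xu0 \<omega>, xl0 \<omega>)))"
proof (induction t)
  case 0
  show ?case by (simp add: case_prod_beta)
next
  case (Suc t)
  have "integral\<^sup>L M (traj A B C E F Lu Ll Ku Kl w v x0 xu0 xl0 (Suc t))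
      = (\<lambda>(X, w, v). closed_loop_step A B C E F Lu Ll Ku Kl w v X)
          (integral\<^sup>L M (\<lambda>\<omega>. (traj A B C E F Lu Ll Ku Kl w v x0 xu0 xl0 t \<omega>, w t \<omega>, v t \<omega>)))"
    unfolding traj_Suc_closed_loop_step
    using integral_bounded_linear[OF bounded_linear_closed_loop_step[of A B C E F Lu Ll Ku Kl]
        integrable_Pair[OF integrable_traj integrable_Pair[OF w_int v_int]]]
    by simp
  also have "\<dots> = closed_loop_step A B C E F Lu Ll Ku Kl w_mean v_mean
      (integral\<^sup>L M (traj A B C E F Lu Ll Ku Kl w v x0 xu0 xl0 t))"
    by (simp add: integral_Pair integrable_Pair integrable_traj w_int v_int assms)
  finally show ?case by (simp add: Suc del: traj.simps)
qed

end

lemma Xset_fst_nonneg: "X \<in> Xset \<Longrightarrow> 0 \<le> fst X"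
  by (auto simp: Xset_def)

lemma expected_traj_stable_iff_mean_stable:
  fixes M :: "'a measure" and w :: "nat \<Rightarrow> 'a \<Rightarrow> real^'q" and v :: "nat \<Rightarrow> 'a \<Rightarrow> real^'r"
  assumes "prob_space M"
    and w_int: "\<And>t. integrable M (w t)" and v_int: "\<And>t. integrable M (v t)"
    and w_mean: "\<And>t. integral\<^sup>L M (w t) = w_mean" and v_mean: "\<And>t. integral\<^sup>L M (v t) = v_mean"
  shows "(\<forall>x0 xu0 xl0 :: 'a \<Rightarrow> real^'n.
        integrable M x0 \<longrightarrow> integrable M xu0 \<longrightarrow> integrable M xl0 \<longrightarrow>
        (\<forall>\<omega>\<in>space M. 0 \<le> x0 \<omega>) \<longrightarrow> integral\<^sup>L M (\<lambda>\<omega>. (x0 \<omega>, xu0 \<omega>, xl0 \<omega>)) \<in> Xset \<longrightarrow>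
        (let X = (\<lambda>t. integral\<^sup>L M (traj A B C E F Lu Ll Ku Kl w v x0 xu0 xl0 t))
         in (\<forall>t. X t \<in> Xset) \<and> X \<longlonglongrightarrow> Xs))
    \<longleftrightarrow> (\<forall>X0\<in>Xset.
        (\<forall>t. (closed_loop_step A B C E F Lu Ll Ku Kl w_mean v_mean ^^ t) X0 \<in> Xset) \<and>
        (\<lambda>t. (closed_loop_step A B C E F Lu Ll Ku Kl w_mean v_mean ^^ t) X0) \<longlonglongrightarrow> Xs)"
    (is "?random \<longleftrightarrow> ?deterministic")
proof
  interpret prob_space M by fact
  note mean = integral_traj[OF w_int v_int _ _ _ w_mean v_mean]
  show "?random" if ?deterministic
    using that by (auto simp: mean Let_def)
  show ?deterministic if ?random
  proof
    fix X0 :: "(real^'n) \<times> (real^'n) \<times> (real^'n)" assume "X0 \<in> Xset"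
    \<comment> \<open>A deterministic initial condition is a constant random variable.\<close>
    have "integral\<^sup>L M (\<lambda>_. X0) = X0"
      by (simp add: prob_space)
    with that[rule_format, of "\<lambda>_. fst X0" "\<lambda>_. fst (snd X0)" "\<lambda>_. snd (snd X0)"]
      Xset_fst_nonneg[OF \<open>X0 \<in> Xset\<close>] \<open>X0 \<in> Xset\<close>
    show "(\<forall>t. (closed_loop_step A B C E F Lu Ll Ku Kl w_mean v_mean ^^ t) X0 \<in> Xset) \<and>
        (\<lambda>t. (closed_loop_step A B C E F Lu Ll Ku Kl w_mean v_mean ^^ t) X0) \<longlonglongrightarrow> Xs"
      by (simp add: Let_def mean)
  qed
qed

section \<open>The mean dynamics\<close>

lemma nonneg_matrix_vector_mult:
  "0 \<le> (N :: 'a::linordered_semidom^'n^'m) \<Longrightarrow> 0 \<le> z \<Longrightarrow> 0 \<le> N *v z"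
  by (auto simp: Finite_Cartesian_Product.less_eq_vec_def matrix_vector_mult_def intro!: sum_nonneg)

lemma nonneg_if_affine_nonneg:
  fixes N :: "real^'n^'m" and c :: "real^'m"
  assumes nonneg: "\<And>z. 0 \<le> z \<Longrightarrow> 0 \<le> N *v z + c"
  shows "0 \<le> N" and "0 \<le> c"
proof -
  show "0 \<le> c" using nonneg[of 0] by simp
  have "0 \<le> N $ i $ j" for i j
  proof (rule ccontr)
    assume "\<not> 0 \<le> N $ i $ j"
    \<comment> \<open>Push far enough along the \<open>j\<close>-th axis to make the \<open>i\<close>-th component negative.\<close>
    define s where "s = (\<bar>c $ i\<bar> + 1) / - (N $ i $ j)"
    have "0 \<le> s" using \<open>\<not> 0 \<le> N $ i $ j\<close> by (simp add: s_def divide_nonneg_neg)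
    hence "0 \<le> (N *v (s *\<^sub>R axis j 1) + c) $ i"
      using nonneg[of "s *\<^sub>R axis j 1"]
      by (simp add: Finite_Cartesian_Product.less_eq_vec_def axis_def)
    moreover have "(N *v (s *\<^sub>R axis j 1) + c) $ i = s * N $ i $ j + c $ i"
      by (simp add: matrix_vector_mult_scaleR matrix_vector_mult_basis column_def)
    moreover have "s * N $ i $ j = - (\<bar>c $ i\<bar> + 1)"
      using \<open>\<not> 0 \<le> N $ i $ j\<close> by (simp add: s_def)
    ultimately show False by linarith
  qed
  thus "0 \<le> N" by (simp add: Finite_Cartesian_Product.less_eq_vec_def)
qed

definition lower_estimate :: "(real^'n) \<times> (real^'n) \<times> (real^'n) \<Rightarrow> real^'n" where
  "lower_estimate X = snd (snd X)"

definition lower_gap :: "(real^'n) \<times> (real^'n) \<times> (real^'n) \<Rightarrow> real^'n" where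
  "lower_gap X = fst X - snd (snd X)"

definition upper_gap :: "(real^'n) \<times> (real^'n) \<times> (real^'n) \<Rightarrow> real^'n" where
  "upper_gap X = fst (snd X) - fst X"

lemma triple_eq_gaps:
  "X = (lower_estimate X + lower_gap X, lower_estimate X + lower_gap X + upper_gap X,
    lower_estimate X)"
  by (simp add: lower_estimate_def lower_gap_def upper_gap_def)

lemma Xset_iff_gaps:
  "X \<in> Xset \<longleftrightarrow> 0 \<le> lower_estimate X \<and> 0 \<le> lower_gap X \<and> 0 \<le> upper_gap X"
  by (cases X)
     (auto simp: Xset_def lower_estimate_def lower_gap_def upper_gap_def
       Finite_Cartesian_Product.less_eq_vec_def; meson order_trans)

lemma closed_Xset: "closed (Xset :: ((real^'n) \<times> (real^'n) \<times> (real^'n)) set)"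
proof -
  have "Xset = lower_estimate -` {0..} \<inter> lower_gap -` {0..}
      \<inter> (upper_gap -` {0..} :: ((real^'n) \<times> (real^'n) \<times> (real^'n)) set)"
    by (auto simp: Xset_iff_gaps)
  moreover have "continuous_on UNIV (lower_estimate :: _ \<Rightarrow> real^'n)"
    "continuous_on UNIV (lower_gap :: _ \<Rightarrow> real^'n)" "continuous_on UNIV (upper_gap :: _ \<Rightarrow> real^'n)"
    unfolding lower_estimate_def[abs_def] lower_gap_def[abs_def] upper_gap_def[abs_def]
    by (intro continuous_intros)+
  ultimately show ?thesis
    by (metis closed_Int closed_vimage closed_eucl_atLeast)
qed

lemma tendsto_gaps:
  assumes "Y \<longlonglongrightarrow> X"
  shows "(\<lambda>t. lower_estimate (Y t)) \<longlonglongrightarrow> lower_estimate X"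
    and "(\<lambda>t. lower_gap (Y t)) \<longlonglongrightarrow> lower_gap X"
    and "(\<lambda>t. upper_gap (Y t)) \<longlonglongrightarrow> upper_gap X"
  unfolding lower_estimate_def lower_gap_def upper_gap_def
  using assms by (auto intro!: tendsto_diff tendsto_fst tendsto_snd)

definition interval_observer_conditions ::
  "real^'n^'n \<Rightarrow> real^'m^'n \<Rightarrow> real^'n^'p \<Rightarrow> real^'q^'n \<Rightarrow> real^'r^'p \<Rightarrow>
   real^'p^'n \<Rightarrow> real^'p^'n \<Rightarrow> real^'n^'m \<Rightarrow> real^'n^'m \<Rightarrow> bool" where
  "interval_observer_conditions A B C E F Lu Ll Ku Kl \<longleftrightarrow>
     schur (A + B ** (Ku + Kl)) \<and> schur (A - Lu ** C) \<and> schur (A - Ll ** C) \<and>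
     0 \<le> A + B ** (Ku + Kl) \<and> 0 \<le> A + B ** Ku \<and> 0 \<le> B ** Ku \<and>
     0 \<le> A - Lu ** C \<and> 0 \<le> A - Ll ** C \<and> 0 \<le> B ** Ku + Ll ** C \<and>
     0 \<le> Lu *v (F *v ones) - E *v ones \<and> 0 \<le> E *v ones - Ll *v (F *v ones) \<and>
     0 \<le> Ll *v (F *v ones)"

context
  fixes A :: "real^'n^'n" and B :: "real^'m^'n" and C :: "real^'n^'p"
    and E :: "real^'q^'n" and F :: "real^'r^'p"
    and Lu Ll :: "real^'p^'n" and Ku Kl :: "real^'n^'m"
begin

abbreviation mean_step ::
  "(real^'n) \<times> (real^'n) \<times> (real^'n) \<Rightarrow> (real^'n) \<times> (real^'n) \<times> (real^'n)" where
  "mean_step \<equiv> closed_loop_step A B C E F Lu Ll Ku Kl ones ones"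

lemmas mean_step_simps = closed_loop_step_def lower_estimate_def lower_gap_def upper_gap_def
  Let_def matrix_vector_mul_assoc[symmetric] matrix_add_ldistrib

lemma lower_gap_mean_step:
  "lower_gap (mean_step X) = (A - Ll ** C) *v lower_gap X + (E *v ones - Ll *v (F *v ones))"
  by (cases X) (simp add: mean_step_simps algebra_simps)

lemma upper_gap_mean_step:
  "upper_gap (mean_step X) = (A - Lu ** C) *v upper_gap X + (Lu *v (F *v ones) - E *v ones)"
  by (cases X) (simp add: mean_step_simps algebra_simps)

lemma lower_estimate_mean_step:
  "lower_estimate (mean_step X) = (A + B ** (Ku + Kl)) *v lower_estimate X
     + ((B ** Ku + Ll ** C) *v lower_gap X + (B ** Ku) *v upper_gap X + Ll *v (F *v ones))"
  by (cases X) (simp add: mean_step_simps algebra_simps)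

lemma fst_mean_step:
  "fst (mean_step X) = (A + B ** (Ku + Kl)) *v lower_estimate X + (A + B ** Ku) *v lower_gap X
     + (B ** Ku) *v upper_gap X + E *v ones"
  by (cases X) (simp add: mean_step_simps algebra_simps)

lemma mean_step_preserves_Xset:
  assumes "0 \<le> A + B ** (Ku + Kl)" "0 \<le> B ** Ku + Ll ** C" "0 \<le> B ** Ku"
    "0 \<le> A - Ll ** C" "0 \<le> A - Lu ** C" "0 \<le> Ll *v (F *v ones)"
    "0 \<le> E *v ones - Ll *v (F *v ones)" "0 \<le> Lu *v (F *v ones) - E *v ones"
    and "X \<in> Xset"
  shows "mean_step X \<in> Xset"
proof -
  have "0 \<le> lower_estimate X" "0 \<le> lower_gap X" "0 \<le> upper_gap X"
    using assms(9) by (simp_all add: Xset_iff_gaps)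
  with assms(1-8) show ?thesis
    unfolding Xset_iff_gaps lower_estimate_mean_step lower_gap_mean_step upper_gap_mean_step
    by (simp del: diff_ge_0_iff_ge add: nonneg_matrix_vector_mult)
qed

lemma mean_step_tendsto:
  assumes "schur (A + B ** (Ku + Kl))" "schur (A - Lu ** C)" "schur (A - Ll ** C)"
  obtains Xs where "\<And>X0. (\<lambda>t. (mean_step ^^ t) X0) \<longlonglongrightarrow> Xs"
proof -
  obtain e1 where e1: "e1 = (A - Ll ** C) *v e1 + (E *v ones - Ll *v (F *v ones))"
    using schur_fixpoint_exists[OF assms(3)] by blast
  obtain e2 where e2: "e2 = (A - Lu ** C) *v e2 + (Lu *v (F *v ones) - E *v ones)"
    using schur_fixpoint_exists[OF assms(2)] by blast
  obtain l where l: "l = (A + B ** (Ku + Kl)) *v l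
      + ((B ** Ku + Ll ** C) *v e1 + (B ** Ku) *v e2 + Ll *v (F *v ones))"
    using schur_fixpoint_exists[OF assms(1)] by blast
  show ?thesis
  proof (rule that)
    fix X0
    define Y where "Y = (\<lambda>t. (mean_step ^^ t) X0)"
    have step: "Y (Suc t) = mean_step (Y t)" for t by (simp add: Y_def)
    \<comment> \<open>The gaps obey autonomous recursions and converge first; they then drive the lower estimate.\<close>
    have gap1: "(\<lambda>t. lower_gap (Y t)) \<longlonglongrightarrow> e1"
      by (rule schur_affine_recursion_tendsto[OF assms(3) e1 _ tendsto_const])
         (simp only: step lower_gap_mean_step)
    have gap2: "(\<lambda>t. upper_gap (Y t)) \<longlonglongrightarrow> e2"
      by (rule schur_affine_recursion_tendsto[OF assms(2) e2 _ tendsto_const])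
         (simp only: step upper_gap_mean_step)
    have "(\<lambda>t. (B ** Ku + Ll ** C) *v lower_gap (Y t) + (B ** Ku) *v upper_gap (Y t)
        + Ll *v (F *v ones)) \<longlonglongrightarrow> (B ** Ku + Ll ** C) *v e1 + (B ** Ku) *v e2 + Ll *v (F *v ones)"
      by (intro tendsto_intros bounded_linear.tendsto[OF matrix_vector_mul_bounded_linear]
          gap1 gap2)
    hence est: "(\<lambda>t. lower_estimate (Y t)) \<longlonglongrightarrow> l"
      by (intro schur_affine_recursion_tendsto[OF assms(1) l])
         (simp only: step lower_estimate_mean_step)
    have "Y = (\<lambda>t. (lower_estimate (Y t) + lower_gap (Y t),
        lower_estimate (Y t) + lower_gap (Y t) + upper_gap (Y t), lower_estimate (Y t)))"
      by (rule ext) (rule triple_eq_gaps)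
    also have "\<dots> \<longlonglongrightarrow> (l + e1, l + e1 + e2, l)"
      by (intro tendsto_Pair tendsto_add est gap1 gap2)
    finally show "(\<lambda>t. (mean_step ^^ t) X0) \<longlonglongrightarrow> (l + e1, l + e1 + e2, l)"
      unfolding Y_def .
  qed
qed

lemma mean_step_stable_if_conditions:
  assumes "interval_observer_conditions A B C E F Lu Ll Ku Kl"
  shows "\<exists>Xs\<in>Xset. \<forall>X0\<in>Xset.
    (\<forall>t. (mean_step ^^ t) X0 \<in> Xset) \<and> (\<lambda>t. (mean_step ^^ t) X0) \<longlonglongrightarrow> Xs"
proof -
  have invariant: "(mean_step ^^ t) X0 \<in> Xset" if "X0 \<in> Xset" for X0 t
    using assms that
    by (induction t)
       (simp_all add: interval_observer_conditions_def mean_step_preserves_Xset del: vec_1)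
  obtain Xs where lim: "\<And>X0. (\<lambda>t. (mean_step ^^ t) X0) \<longlonglongrightarrow> Xs"
    using mean_step_tendsto assms unfolding interval_observer_conditions_def by blast
  have "(0, 0, 0) \<in> (Xset :: ((real^'n) \<times> (real^'n) \<times> (real^'n)) set)"
    by (simp add: Xset_def)
  hence "Xs \<in> Xset"
    by (intro Lim_in_closed_set[OF closed_Xset always_eventually trivial_limit_sequentially lim]
        allI invariant)
  thus ?thesis using invariant lim by blast
qed

lemma sign_conditions_if_mean_step_preserves_Xset:
  assumes invariant: "\<And>X. X \<in> Xset \<Longrightarrow> mean_step X \<in> Xset"
  shows "0 \<le> A + B ** (Ku + Kl) \<and> 0 \<le> A + B ** Ku \<and> 0 \<le> B ** Ku \<and>
    0 \<le> A - Lu ** C \<and> 0 \<le> A - Ll ** C \<and> 0 \<le> B ** Ku + Ll ** C \<and>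
    0 \<le> Lu *v (F *v ones) - E *v ones \<and> 0 \<le> E *v ones - Ll *v (F *v ones) \<and>
    0 \<le> Ll *v (F *v ones)"
proof -
  note gap_defs = lower_estimate_def lower_gap_def upper_gap_def
  \<comment> \<open>Invariance at the points \<open>(z, z, 0)\<close>, \<open>(z, z, z)\<close>, \<open>(0, z, 0)\<close> of \<open>Xset\<close>, \<open>z \<ge> 0\<close>,
    isolates each sign condition.\<close>
  have "(z, z, 0) \<in> Xset" "(z, z, z) \<in> Xset" "(0, z, 0) \<in> Xset" if "0 \<le> z" for z :: "real^'n"
    using that by (simp_all add: Xset_def)
  note corner1 = invariant[OF this(1)] and corner2 = invariant[OF this(2)]
    and corner3 = invariant[OF this(3)]
  have est1: "0 \<le> (B ** Ku + Ll ** C) *v z + Ll *v (F *v ones)" if "0 \<le> z" for z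
    using corner1[OF that] unfolding Xset_iff_gaps lower_estimate_mean_step by (simp add: gap_defs)
  have gap1: "0 \<le> (A - Ll ** C) *v z + (E *v ones - Ll *v (F *v ones))" if "0 \<le> z" for z
    using corner1[OF that] unfolding Xset_iff_gaps lower_gap_mean_step by (simp add: gap_defs)
  have state1: "0 \<le> (A + B ** Ku) *v z + E *v ones" if "0 \<le> z" for z
    using Xset_fst_nonneg[OF corner1[OF that]] unfolding fst_mean_step by (simp add: gap_defs)
  have est2: "0 \<le> (A + B ** (Ku + Kl)) *v z + Ll *v (F *v ones)" if "0 \<le> z" for z
    using corner2[OF that] unfolding Xset_iff_gaps lower_estimate_mean_step by (simp add: gap_defs)
  have est3: "0 \<le> (B ** Ku) *v z + Ll *v (F *v ones)" if "0 \<le> z" for z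
    using corner3[OF that] unfolding Xset_iff_gaps lower_estimate_mean_step by (simp add: gap_defs)
  have gap3: "0 \<le> (A - Lu ** C) *v z + (Lu *v (F *v ones) - E *v ones)" if "0 \<le> z" for z
    using corner3[OF that] unfolding Xset_iff_gaps upper_gap_mean_step by (simp add: gap_defs)
  show ?thesis
    using nonneg_if_affine_nonneg[OF est1] nonneg_if_affine_nonneg[OF gap1]
      nonneg_if_affine_nonneg[OF state1] nonneg_if_affine_nonneg[OF est2]
      nonneg_if_affine_nonneg[OF est3] nonneg_if_affine_nonneg[OF gap3]
    by blast
qed

lemma schur_conditions_if_mean_step_converges:
  assumes lim: "\<And>X0. X0 \<in> Xset \<Longrightarrow> (\<lambda>t. (mean_step ^^ t) X0) \<longlonglongrightarrow> Xs"
  shows "schur (A + B ** (Ku + Kl)) \<and> schur (A - Lu ** C) \<and> schur (A - Ll ** C)"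
proof -
  define Y where "Y X0 t = (mean_step ^^ t) X0" for X0 t
  have step: "Y X0 (Suc t) = mean_step (Y X0 t)" for X0 t
    by (simp add: Y_def)
  have start: "Y X0 0 = X0" for X0
    by (simp add: Y_def)
  have zero_in_Xset: "((0, 0, 0) :: (real^'n) \<times> (real^'n) \<times> (real^'n)) \<in> Xset"
    by (simp add: Xset_def)
  have in_Xset: "(z, z, 0) \<in> Xset" "(z, z, z) \<in> Xset" "(0, z, 0) \<in> Xset"
    if "0 \<le> z" for z :: "real^'n"
    using that by (simp_all add: Xset_def)
  have diff_tendsto_zero:
    "(\<lambda>t. lower_estimate (Y X1 t) - lower_estimate (Y (0, 0, 0) t)) \<longlonglongrightarrow> 0"
    "(\<lambda>t. lower_gap (Y X1 t) - lower_gap (Y (0, 0, 0) t)) \<longlonglongrightarrow> 0"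
    "(\<lambda>t. upper_gap (Y X1 t) - upper_gap (Y (0, 0, 0) t)) \<longlonglongrightarrow> 0"
    if "X1 \<in> Xset" for X1
    using tendsto_diff[OF tendsto_gaps(1)[OF lim[OF that]] tendsto_gaps(1)[OF lim[OF zero_in_Xset]]]
      tendsto_diff[OF tendsto_gaps(2)[OF lim[OF that]] tendsto_gaps(2)[OF lim[OF zero_in_Xset]]]
      tendsto_diff[OF tendsto_gaps(3)[OF lim[OF that]] tendsto_gaps(3)[OF lim[OF zero_in_Xset]]]
    by (simp_all add: Y_def)
  have lower_gap_diff: "lower_gap (Y X1 t) - lower_gap (Y X0 t)
      = ((*v) (A - Ll ** C) ^^ t) (lower_gap (Y X1 0) - lower_gap (Y X0 0))" for X0 X1 t
    by (rule affine_recursion_diff[of "\<lambda>t. lower_gap (Y X0 t)" _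
          "\<lambda>_. E *v ones - Ll *v (F *v ones)"])
       (simp_all only: step lower_gap_mean_step)
  have upper_gap_diff: "upper_gap (Y X1 t) - upper_gap (Y X0 t)
      = ((*v) (A - Lu ** C) ^^ t) (upper_gap (Y X1 0) - upper_gap (Y X0 0))" for X0 X1 t
    by (rule affine_recursion_diff[of "\<lambda>t. upper_gap (Y X0 t)" _
          "\<lambda>_. Lu *v (F *v ones) - E *v ones"])
       (simp_all only: step upper_gap_mean_step)
  have "schur (A - Ll ** C)"
  proof (rule schur_if_powers_tendsto_zero, rule powers_tendsto_zero_if_nonneg)
    fix z :: "real^'n" assume "0 \<le> z"
    show "(\<lambda>t. ((*v) (A - Ll ** C) ^^ t) z) \<longlonglongrightarrow> 0"
      using diff_tendsto_zero(2)[OF in_Xset(1)[OF \<open>0 \<le> z\<close>], unfolded lower_gap_diff start]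
      by (simp add: lower_gap_def)
  qed
  moreover have "schur (A - Lu ** C)"
  proof (rule schur_if_powers_tendsto_zero, rule powers_tendsto_zero_if_nonneg)
    fix z :: "real^'n" assume "0 \<le> z"
    show "(\<lambda>t. ((*v) (A - Lu ** C) ^^ t) z) \<longlonglongrightarrow> 0"
      using diff_tendsto_zero(3)[OF in_Xset(3)[OF \<open>0 \<le> z\<close>], unfolded upper_gap_diff start]
      by (simp add: upper_gap_def)
  qed
  moreover have "schur (A + B ** (Ku + Kl))"
  proof (rule schur_if_powers_tendsto_zero, rule powers_tendsto_zero_if_nonneg)
    fix z :: "real^'n" assume "0 \<le> z"
    let ?Z = "(z, z, z)" and ?O = "(0, 0, 0) :: (real^'n) \<times> (real^'n) \<times> (real^'n)"
    \<comment> \<open>Both trajectories start with zero gaps, so their gaps agree forever and the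
      lower estimates follow the same forced recursion.\<close>
    have "lower_gap (Y ?Z t) = lower_gap (Y ?O t)" "upper_gap (Y ?Z t) = upper_gap (Y ?O t)" for t
      using lower_gap_diff[of ?Z t ?O] upper_gap_diff[of ?Z t ?O]
      by (simp_all add: start lower_gap_def upper_gap_def)
    hence "lower_estimate (Y ?Z t) - lower_estimate (Y ?O t)
        = ((*v) (A + B ** (Ku + Kl)) ^^ t) (lower_estimate (Y ?Z 0) - lower_estimate (Y ?O 0))"
      for t
      by (intro affine_recursion_diff[of "\<lambda>t. lower_estimate (Y ?O t)" _
          "\<lambda>t. (B ** Ku + Ll ** C) *v lower_gap (Y ?O t) + (B ** Ku) *v upper_gap (Y ?O t)
            + Ll *v (F *v ones)"])
         (simp_all only: step lower_estimate_mean_step)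
    hence "lower_estimate (Y ?Z t) - lower_estimate (Y ?O t) = ((*v) (A + B ** (Ku + Kl)) ^^ t) z"
      for t
      by (simp add: start lower_estimate_def)
    thus "(\<lambda>t. ((*v) (A + B ** (Ku + Kl)) ^^ t) z) \<longlonglongrightarrow> 0"
      using diff_tendsto_zero(1)[OF in_Xset(2)[OF \<open>0 \<le> z\<close>]] by simp
  qed
  ultimately show ?thesis by blast
qed

lemma interval_observer_conditions_iff_mean_step_stable:
  "interval_observer_conditions A B C E F Lu Ll Ku Kl \<longleftrightarrow>
    (\<exists>Xs\<in>Xset. \<forall>X0\<in>Xset. (\<forall>t. (mean_step ^^ t) X0 \<in> Xset) \<and>
      (\<lambda>t. (mean_step ^^ t) X0) \<longlonglongrightarrow> Xs)"
proof
  assume "\<exists>Xs\<in>Xset. \<forall>X0\<in>Xset. (\<forall>t. (mean_step ^^ t) X0 \<in> Xset) \<and>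
    (\<lambda>t. (mean_step ^^ t) X0) \<longlonglongrightarrow> Xs"
  then obtain Xs where stable: "\<And>X0. X0 \<in> Xset \<Longrightarrow>
      (\<forall>t. (mean_step ^^ t) X0 \<in> Xset) \<and>
      (\<lambda>t. (mean_step ^^ t) X0) \<longlonglongrightarrow> Xs"
    by blast
  have "(mean_step ^^ 1) X \<in> Xset" if "X \<in> Xset" for X
    using stable[OF that] by blast
  hence "mean_step X \<in> Xset" if "X \<in> Xset" for X
    using that by simp
  from sign_conditions_if_mean_step_preserves_Xset[OF this]
    schur_conditions_if_mean_step_converges[OF conjunct2[OF stable]]
  show "interval_observer_conditions A B C E F Lu Ll Ku Kl"
    unfolding interval_observer_conditions_def by blast
qed (rule mean_step_stable_if_conditions)

end

theorem theorem2:
  fixes M :: "'a measure"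
    and A :: "real^'n^'n" and B :: "real^'m^'n" and C :: "real^'n^'p"
    and E :: "real^'q^'n" and F :: "real^'r^'p"
    and Lu Ll :: "real^'p^'n" and Ku Kl :: "real^'n^'m"
    and w :: "nat \<Rightarrow> 'a \<Rightarrow> real^'q" and v :: "nat \<Rightarrow> 'a \<Rightarrow> real^'r"
  assumes "prob_space M"
    and "0 \<le> A" and "0 \<le> E"
    and w_int: "\<And>t. integrable M (w t)"
    and w_nn: "\<And>t \<omega>. \<omega> \<in> space M \<Longrightarrow> 0 \<le> w t \<omega>"
    and w_mean: "\<And>t. integral\<^sup>L M (w t) = ones"
    and v_int: "\<And>t. integrable M (v t)"
    and v_nn: "\<And>t \<omega>. \<omega> \<in> space M \<Longrightarrow> 0 \<le> v t \<omega>"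
    and v_mean: "\<And>t. integral\<^sup>L M (v t) = ones"
  shows "(schur (A + B ** (Ku + Kl)) \<and> schur (A - Lu ** C) \<and> schur (A - Ll ** C) \<and>
          0 \<le> A + B ** (Ku + Kl) \<and> 0 \<le> A + B ** Ku \<and> 0 \<le> B ** Ku \<and>
          0 \<le> A - Lu ** C \<and> 0 \<le> A - Ll ** C \<and> 0 \<le> B ** Ku + Ll ** C \<and>
          0 \<le> Lu *v (F *v ones) - E *v ones \<and> 0 \<le> E *v ones - Ll *v (F *v ones) \<and>
          0 \<le> Ll *v (F *v ones))
     \<longleftrightarrow>
         (\<exists>Xstar \<in> Xset.
            \<forall>x0 xu0 xl0 :: 'a \<Rightarrow> real^'n.
              integrable M x0 \<longrightarrow> integrable M xu0 \<longrightarrow> integrable M xl0 \<longrightarrow>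
              (\<forall>\<omega>\<in>space M. 0 \<le> x0 \<omega>) \<longrightarrow>
              integral\<^sup>L M (\<lambda>\<omega>. (x0 \<omega>, xu0 \<omega>, xl0 \<omega>)) \<in> Xset \<longrightarrow>
              (let X = (\<lambda>t. integral\<^sup>L M (traj A B C E F Lu Ll Ku Kl w v x0 xu0 xl0 t))
               in (\<forall>t. X t \<in> Xset) \<and> X \<longlonglongrightarrow> Xstar))"
proof -
  \<comment> \<open>Only the means of the noise enter.\<close>
  have "(\<forall>x0 xu0 xl0 :: 'a \<Rightarrow> real^'n.
        integrable M x0 \<longrightarrow> integrable M xu0 \<longrightarrow> integrable M xl0 \<longrightarrow>
        (\<forall>\<omega>\<in>space M. 0 \<le> x0 \<omega>) \<longrightarrow> integral\<^sup>L M (\<lambda>\<omega>. (x0 \<omega>, xu0 \<omega>, xl0 \<omega>)) \<in> Xset \<longrightarrow>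
        (let X = (\<lambda>t. integral\<^sup>L M (traj A B C E F Lu Ll Ku Kl w v x0 xu0 xl0 t))
         in (\<forall>t. X t \<in> Xset) \<and> X \<longlonglongrightarrow> Xs))
      \<longleftrightarrow> (\<forall>X0\<in>Xset. (\<forall>t. (mean_step A B C E F Lu Ll Ku Kl ^^ t) X0 \<in> Xset) \<and>
        (\<lambda>t. (mean_step A B C E F Lu Ll Ku Kl ^^ t) X0) \<longlonglongrightarrow> Xs)" for Xs
    by (rule expected_traj_stable_iff_mean_stable[OF assms(1) w_int v_int w_mean v_mean])
  thus ?thesis
    unfolding interval_observer_conditions_def[symmetric]
      interval_observer_conditions_iff_mean_step_stable
    by (intro bex_cong) auto
qed

end
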